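(* Let $m\ge 0$ be an integer and let $\boldsymbol g=(g_0,\dots,g_m)\in\mathbb R^{m+1}$. Let $G_{\boldsymbol g}=\sum_{j=0}^m g_jB_j^{(m)}$ and $H_{\boldsymbol g}=\sum_{j=0}^m g_jP_j^{(m)}$ on $[-1,1]$. (a) If $g_j>0$ for all $j$, then $G_{\boldsymbol g}$ has exactly one zero in $(-1,1)$, located at $u=0$; and $H=H_{\boldsymbol g}$ satisfies $H(\pm1)=H'(\pm1)=0$, $H(u)>0$ for $-1<u<1$, $H''(\pm1)=2g_m>0$ and $H''(0)=-g_0<0$. Hence $H$ has two stable pure phases at $u=\pm1$ and exactly one interior stationary point, the central maximum at $u=0$. (b) If $g_j\ge 0$ for all $j$ and $\boldsymbol g\ne\boldsymbol 0$, then $G_{\boldsymbol g}$ still has its only zero in $(-1,1)$ at $u=0$, and $H_{\boldsymbol g}>0$ on $(-1,1)$.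
   Context: For an integer $m\ge0$ and $j=0,\dots,m$, define on $[-1,1]$ $$B_j^{(m)}(u)=-u(1-u^2)\binom{m}{j}(u^2)^j(1-u^2)^{m-j},\qquad P_j^{(m)}(u)=\int_{-1}^uB_j^{(m)}(z)\,\mathrm dz,$$ with the convention that a zeroth power equals $1$. Thus $H_{\boldsymbol g}'=G_{\boldsymbol g}$. A stable pure phase at $u=\pm1$ means that $H'(\pm1)=0$ and $H''(\pm1)>0$. *)

theory Defs
  imports "HOL-Analysis.Analysis"
begin

definition B :: "nat \<Rightarrow> nat \<Rightarrow> real \<Rightarrow> real" where
  "B m j u = - u * (1 - u^2) * real (m choose j) * (u^2)^j * (1 - u^2)^(m - j)"

definition P :: "nat \<Rightarrow> nat \<Rightarrow> real \<Rightarrow> real" where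
  "P m j u = integral {-1..u} (B m j)"

(* The vector (g_0, ..., g_m) is encoded by the values of g at the indices up to m. *)
definition G :: "nat \<Rightarrow> (nat \<Rightarrow> real) \<Rightarrow> real \<Rightarrow> real" where
  "G m g u = (\<Sum>j=0..m. g j * B m j u)"

definition H :: "nat \<Rightarrow> (nat \<Rightarrow> real) \<Rightarrow> real \<Rightarrow> real" where
  "H m g u = (\<Sum>j=0..m. g j * P m j u)"

(* The functions live on [-1,1], so derivatives are taken within that interval:
   one-sided at the endpoints, the usual two-sided ones in the interior. *)
definition has_deriv :: "(real \<Rightarrow> real) \<Rightarrow> real \<Rightarrow> real \<Rightarrow> bool" where
  "has_deriv f d u \<longleftrightarrow> (f has_real_derivative d) (at u within {-1..1})"

definition has_second_deriv :: "(real \<Rightarrow> real) \<Rightarrow> real \<Rightarrow> real \<Rightarrow> bool" where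
  "has_second_deriv f d u \<longleftrightarrow>
     (\<exists>f'. (\<forall>x\<in>{-1..1}. has_deriv f (f' x) x) \<and> has_deriv f' d u)"

definition stable_pure_phase :: "(real \<Rightarrow> real) \<Rightarrow> real \<Rightarrow> bool" where
  "stable_pure_phase f u \<longleftrightarrow>
     u \<in> {-1, 1} \<and> has_deriv f 0 u \<and> (\<exists>d>0. has_second_deriv f d u)"

end

theory Submission
  imports Defs
begin

text \<open>
  Every \<open>B m j\<close> carries the common factor \<open>-u (1 - u\<^sup>2)\<close>, so \<open>G m g\<close> is that factor times a
  Bernstein polynomial in \<open>u\<^sup>2\<close> with control values \<open>g 0, \<dots>, g m\<close>, called \<open>W m g\<close> below.
  For \<open>0 < u\<^sup>2 < 1\<close> all Bernstein basis polynomials are strictly positive, so nonnegative control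
  values that are not all zero make \<open>W m g\<close> positive there (\<open>W_pos\<close>). Hence \<open>G m g\<close> is positive
  on \<open>(-1,0)\<close>, negative on \<open>(0,1)\<close>, and vanishes at \<open>0\<close> because of the factor \<open>u\<close>, whatever
  the value of \<open>W m g\<close> at \<open>0\<close>.

  Since \<open>H m g\<close> is a primitive of \<open>G m g\<close> (\<open>H_has_derivative\<close>), it is strictly increasing on
  \<open>[-1,0]\<close> and strictly decreasing on \<open>[0,1]\<close>. It vanishes at \<open>-1\<close> by construction and at \<open>1\<close>
  because the integrand is odd, so it is positive in between and maximal at \<open>0\<close>.

  The second derivatives come from the product rule: at \<open>0\<close> and \<open>\<plusminus>1\<close> the factor \<open>-u (1 - u\<^sup>2)\<close>
  vanishes, so only its own derivative \<open>3 u\<^sup>2 - 1\<close> times \<open>W m g\<close> survives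
  (\<open>G_has_derivative_at_root\<close>), and a Bernstein polynomial takes its end control values
  \<open>g 0\<close> and \<open>g m\<close> at the ends of the unit interval.
\<close>

section \<open>The Bernstein factor\<close>

definition W :: "nat \<Rightarrow> (nat \<Rightarrow> real) \<Rightarrow> real \<Rightarrow> real" where
  "W m g u = (\<Sum>j=0..m. g j * (real (m choose j) * (u^2)^j * (1 - u^2)^(m - j)))"

lemma G_factorization: "G m g u = - u * (1 - u^2) * W m g u"
  unfolding G_def W_def B_def sum_distrib_left by (simp add: mult_ac)

lemma W_at_0: "W m g 0 = g 0"
proof -
  have "W m g 0 = (\<Sum>j=0..m. if j = 0 then g 0 else 0)"
    unfolding W_def by (intro sum.cong) auto
  then show ?thesis by simp
qed

lemma W_at_square_1:
  assumes "u^2 = 1"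
  shows "W m g u = g m"
proof -
  have "W m g u = (\<Sum>j=0..m. if j = m then g m else 0)"
    unfolding W_def by (intro sum.cong) (auto simp: assms)
  then show ?thesis by simp
qed

text \<open>
  The bound \<open>0 < u\<^sup>2\<close> cannot be relaxed: at \<open>u = 0\<close> only the basis polynomial of index \<open>0\<close>
  is nonzero, and \<open>g 0\<close> may vanish.
\<close>

lemma W_pos:
  assumes "\<forall>j\<le>m. g j \<ge> 0" "\<exists>j\<le>m. g j \<noteq> 0" "0 < u^2" "u^2 < 1"
  shows "W m g u > 0"
proof -
  have basis: "real (m choose j) * (u^2)^j * (1 - u^2)^(m - j) > 0" if "j \<le> m" for j
    using that assms(4) by (intro mult_pos_pos zero_less_power[OF assms(3)] zero_less_power) auto
  obtain k where k: "k \<le> m" "g k \<noteq> 0" using assms(2) by blast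
  then have "g k > 0" using assms(1) by (simp add: order_less_le)
  then show ?thesis
    unfolding W_def using k(1) assms(1) basis
    by (intro sum_pos2[where i = k])
      (auto intro!: mult_pos_pos[of "g k"] mult_nonneg_nonneg[of "g _"] intro: less_imp_le)
qed

lemma W_differentiable: "\<exists>d. (W m g has_real_derivative d) (at u within S)"
  unfolding W_def by (rule exI) (rule derivative_eq_intros refl)+

section \<open>Sign and derivative of \<open>G\<close>\<close>

lemma interior_square_bounds:
  fixes u :: real
  assumes "u \<in> {-1<..<1}"
  shows "u^2 < 1"
  using assms by (simp add: abs_square_less_1 abs_less_iff)

lemma G_pos_left:
  assumes "\<forall>j\<le>m. g j \<ge> 0" "\<exists>j\<le>m. g j \<noteq> 0" "-1 < u" "u < 0"
  shows "G m g u > 0"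
proof -
  have "u^2 < 1" using assms(3,4) by (intro interior_square_bounds) auto
  then show ?thesis
    unfolding G_factorization using assms W_pos[OF assms(1,2)] by (intro mult_pos_pos) auto
qed

lemma G_odd: "G m g (-u) = - G m g u"
  by (simp add: G_def B_def sum_negf)

lemma G_neg_right:
  assumes "\<forall>j\<le>m. g j \<ge> 0" "\<exists>j\<le>m. g j \<noteq> 0" "0 < u" "u < 1"
  shows "G m g u < 0"
  using G_pos_left[OF assms(1,2), of "-u"] assms(3,4) by (simp add: G_odd)

lemma G_zeros:
  assumes "\<forall>j\<le>m. g j \<ge> 0" "\<exists>j\<le>m. g j \<noteq> 0"
  shows "{u \<in> {-1<..<1}. G m g u = 0} = {0}"
proof -
  have "u = 0" if "u \<in> {-1<..<1}" "G m g u = 0" for u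
    using that G_pos_left[OF assms, of u] G_neg_right[OF assms, of u] by fastforce
  moreover have "G m g 0 = 0" by (simp add: G_factorization)
  ultimately show ?thesis by auto
qed

text \<open>
  At the three points \<open>-1\<close>, \<open>0\<close>, \<open>1\<close> the derivative of \<open>W m g\<close> is multiplied by zero, so its value
  never has to be computed.
\<close>

lemma G_has_derivative_at_root:
  assumes "u * (1 - u^2) = 0"
  shows "(G m g has_real_derivative (3 * u^2 - 1) * W m g u) (at u within S)"
proof -
  obtain d where d: "(W m g has_real_derivative d) (at u within S)"
    using W_differentiable by blast
  have factor: "((\<lambda>u. - u * (1 - u^2)) has_real_derivative (3 * u^2 - 1)) (at u within S)"
    by (auto intro!: derivative_eq_intros simp: power2_eq_square algebra_simps)
  have eq: "G m g = (\<lambda>u. - u * (1 - u^2) * W m g u)"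
    by (rule ext) (rule G_factorization)
  have "- u * (1 - u^2) = 0" using assms by simp
  then show ?thesis
    unfolding eq using DERIV_mult[OF factor d] by (simp only: mult_zero_right add_0_right)
qed

section \<open>The primitive \<open>H\<close>\<close>

lemma H_has_derivative:
  assumes "u \<in> {-1..1}"
  shows "has_deriv (H m g) (G m g u) u"
proof -
  have cont: "continuous_on {-1..1} (B m j)" for j
    unfolding B_def by (intro continuous_intros)
  have "(P m j has_real_derivative B m j u) (at u within {-1..1})" for j
    using integral_has_real_derivative[OF cont assms] unfolding P_def .
  then show ?thesis
    unfolding has_deriv_def H_def G_def by (intro DERIV_sum DERIV_cmult)
qed

lemma H_has_derivative_interior:
  assumes "u \<in> {-1<..<1}"
  shows "(H m g has_real_derivative G m g u) (at u)"
proof -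
  have "at u within {-1..1} = at u" using assms by (intro at_within_Icc_at) auto
  then show ?thesis using H_has_derivative[of u m g] assms by (simp add: has_deriv_def)
qed

lemma H_has_second_derivative_at_root:
  assumes "u * (1 - u^2) = 0"
  shows "has_second_deriv (H m g) ((3 * u^2 - 1) * W m g u) u"
  unfolding has_second_deriv_def
  using H_has_derivative G_has_derivative_at_root[OF assms] unfolding has_deriv_def by blast

lemma continuous_on_H: "continuous_on {-1..1} (H m g)"
  using H_has_derivative unfolding has_deriv_def by (rule DERIV_continuous_on)

lemma H_at_minus_1: "H m g (-1) = 0"
  by (simp add: H_def P_def)

text \<open>
  Oddness of each \<open>B m j\<close> closes the primitive up at \<open>1\<close>; this boundary value gives positivity of
  \<open>H m g\<close> on the right half, where \<open>H m g\<close> decreases.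
\<close>

lemma H_at_1: "H m g 1 = 0"
proof -
  have "P m j 1 = 0" for j
  proof -
    have "integral {-1..1} (B m j) = integral {-1..1} (\<lambda>x. B m j (- x))"
      using Henstock_Kurzweil_Integration.integral_reflect_real[of 1 "-1" "B m j"] by simp
    also have "\<dots> = - integral {-1..1} (B m j)"
      by (subst integral_neg[symmetric]) (simp add: B_def)
    finally show ?thesis by (simp add: P_def)
  qed
  then show ?thesis by (simp add: H_def)
qed

lemma H_increasing_left:
  assumes "\<forall>j\<le>m. g j \<ge> 0" "\<exists>j\<le>m. g j \<noteq> 0" "-1 \<le> a" "a < b" "b \<le> 0"
  shows "H m g a < H m g b"
proof (rule DERIV_pos_imp_increasing_open[OF assms(4)])
  show "\<exists>y. (H m g has_real_derivative y) (at x) \<and> 0 < y" if "a < x" "x < b" for x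
    using that assms(3,5) G_pos_left[OF assms(1,2), of x] H_has_derivative_interior[of x m g]
    by auto
  show "continuous_on {a..b} (H m g)"
    using assms(3-5) by (intro continuous_on_subset[OF continuous_on_H]) auto
qed

lemma H_decreasing_right:
  assumes "\<forall>j\<le>m. g j \<ge> 0" "\<exists>j\<le>m. g j \<noteq> 0" "0 \<le> a" "a < b" "b \<le> 1"
  shows "H m g b < H m g a"
proof (rule DERIV_neg_imp_decreasing_open[OF assms(4)])
  show "\<exists>y. (H m g has_real_derivative y) (at x) \<and> y < 0" if "a < x" "x < b" for x
    using that assms(3,5) G_neg_right[OF assms(1,2), of x] H_has_derivative_interior[of x m g]
    by auto
  show "continuous_on {a..b} (H m g)"
    using assms(3-5) by (intro continuous_on_subset[OF continuous_on_H]) auto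
qed

lemma H_pos:
  assumes "\<forall>j\<le>m. g j \<ge> 0" "\<exists>j\<le>m. g j \<noteq> 0" "u \<in> {-1<..<1}"
  shows "H m g u > 0"
proof (cases "u \<le> 0")
  case True
  then show ?thesis
    using H_increasing_left[OF assms(1,2), of "-1" u] assms(3) by (simp add: H_at_minus_1)
next
  case False
  then show ?thesis
    using H_decreasing_right[OF assms(1,2), of u 1] assms(3) by (simp add: H_at_1)
qed

lemma H_le_central_value:
  assumes "\<forall>j\<le>m. g j \<ge> 0" "\<exists>j\<le>m. g j \<noteq> 0" "u \<in> {-1..1}"
  shows "H m g u \<le> H m g 0"
  using H_increasing_left[OF assms(1,2), of u 0] H_decreasing_right[OF assms(1,2), of 0 u] assms(3)
  by (cases u "0 :: real" rule: linorder_cases) auto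

text \<open>
  At an interior point the derivative within \<open>[-1,1]\<close> is the two-sided one, hence unique, so a
  stationary point of \<open>H m g\<close> can only be a zero of \<open>G m g\<close>.
\<close>

lemma stationary_iff_G_zero:
  assumes "u \<in> {-1<..<1}"
  shows "has_deriv (H m g) 0 u \<longleftrightarrow> G m g u = 0"
proof
  have at: "at u within {-1..1} = at u" using assms by (intro at_within_Icc_at) auto
  assume "has_deriv (H m g) 0 u"
  then show "G m g u = 0"
    using DERIV_unique[OF H_has_derivative_interior[OF assms]] by (simp add: has_deriv_def at)
next
  assume "G m g u = 0"
  then show "has_deriv (H m g) 0 u" using H_has_derivative[of u m g] assms by auto
qed

section \<open>The phase structure\<close>

theorem mainTheorem4:
  fixes m :: nat and g :: "nat \<Rightarrow> real"
  shows "((\<forall>j\<le>m. g j > 0) \<longrightarrow>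
            {u \<in> {-1<..<1}. G m g u = 0} = {0} \<and>
            H m g (-1) = 0 \<and> H m g 1 = 0 \<and>
            has_deriv (H m g) 0 (-1) \<and> has_deriv (H m g) 0 1 \<and>
            (\<forall>u\<in>{-1<..<1}. H m g u > 0) \<and>
            has_second_deriv (H m g) (2 * g m) (-1) \<and>
            has_second_deriv (H m g) (2 * g m) 1 \<and> 2 * g m > 0 \<and>
            has_second_deriv (H m g) (- g 0) 0 \<and> - g 0 < 0 \<and>
            stable_pure_phase (H m g) (-1) \<and> stable_pure_phase (H m g) 1 \<and>
            {u \<in> {-1<..<1}. has_deriv (H m g) 0 u} = {0} \<and>
            (\<forall>u\<in>{-1..1}. H m g u \<le> H m g 0))
       \<and> ((\<forall>j\<le>m. g j \<ge> 0) \<and> (\<exists>j\<le>m. g j \<noteq> 0) \<longrightarrow>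
            {u \<in> {-1<..<1}. G m g u = 0} = {0} \<and>
            (\<forall>u\<in>{-1<..<1}. H m g u > 0))"
proof (intro conjI[where P = "_ \<longrightarrow> _"] impI)
  assume pos: "\<forall>j\<le>m. g j > 0"
  have nonneg: "\<forall>j\<le>m. g j \<ge> 0" using pos by (auto intro: less_imp_le)
  have ends: "g 0 > 0" "g m > 0" using pos by auto
  have nonzero: "\<exists>j\<le>m. g j \<noteq> 0" using ends(1) by (intro exI[of _ 0]) simp
  have d1: "has_deriv (H m g) 0 (-1)" "has_deriv (H m g) 0 1"
    using H_has_derivative[of "-1" m g] H_has_derivative[of 1 m g]
    by (simp_all add: G_factorization)
  have d2: "has_second_deriv (H m g) (2 * g m) (-1)" "has_second_deriv (H m g) (2 * g m) 1"
    "has_second_deriv (H m g) (- g 0) 0"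
    using H_has_second_derivative_at_root[of "-1" m g] H_has_second_derivative_at_root[of 1 m g]
      H_has_second_derivative_at_root[of 0 m g]
    by (simp_all add: W_at_0 W_at_square_1)
  have stable: "stable_pure_phase (H m g) (-1)" "stable_pure_phase (H m g) 1"
    unfolding stable_pure_phase_def using d1 d2 ends by (auto intro!: exI[of _ "2 * g m"])
  have stationary: "{u \<in> {-1<..<1}. has_deriv (H m g) 0 u} = {0}"
    using G_zeros[OF nonneg nonzero] stationary_iff_G_zero by blast
  show "{u \<in> {-1<..<1}. G m g u = 0} = {0} \<and>
      H m g (-1) = 0 \<and> H m g 1 = 0 \<and>
      has_deriv (H m g) 0 (-1) \<and> has_deriv (H m g) 0 1 \<and>
      (\<forall>u\<in>{-1<..<1}. H m g u > 0) \<and>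
      has_second_deriv (H m g) (2 * g m) (-1) \<and>
      has_second_deriv (H m g) (2 * g m) 1 \<and> 2 * g m > 0 \<and>
      has_second_deriv (H m g) (- g 0) 0 \<and> - g 0 < 0 \<and>
      stable_pure_phase (H m g) (-1) \<and> stable_pure_phase (H m g) 1 \<and>
      {u \<in> {-1<..<1}. has_deriv (H m g) 0 u} = {0} \<and>
      (\<forall>u\<in>{-1..1}. H m g u \<le> H m g 0)"
    using G_zeros[OF nonneg nonzero] H_at_minus_1 H_at_1 d1 H_pos[OF nonneg nonzero] d2 ends
      stable stationary H_le_central_value[OF nonneg nonzero]
    by (intro conjI ballI) simp_all
next
  assume "(\<forall>j\<le>m. g j \<ge> 0) \<and> (\<exists>j\<le>m. g j \<noteq> 0)"
  then show "{u \<in> {-1<..<1}. G m g u = 0} = {0} \<and> (\<forall>u\<in>{-1<..<1}. H m g u > 0)"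
    using G_zeros H_pos by blast
qed

end
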